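(* Let $\zeta_1,\dots,\zeta_n$ be $n$ independent identically distributed real random variables, and let $\xi_1,\dots,\xi_n$ be real random variables, each $\xi_i$ being conditioned and dependent on the corresponding $\zeta_i$. Suppose the conditional null hypothesis is true, that is, each $\xi_i$ is distributed with the conditional cumulative distribution function $$P(\xi_i\le x\mid\zeta_i)=F_{\zeta_i}(x)=\int_{-\infty}^x f(s,\zeta_i)\,ds .$$ Let $F_{\zeta_i}(\cdot)$ be continuous. Let $S_n$ be the statistic $$S_n=\sup_{x\in[0,1]}\left|\frac1n\sum_{i=1}^n\mathbf{1}_{[0,x]}\bigl(F_{\zeta_i}(\xi_i)\bigr)-x\right|.$$ Then $S_n$ is KS distributed.
   Context: The $\zeta_i$ are $n$ empirical observations of a random variable $\zeta$ with probability density $m$ (possibly unknown), and the $\xi_i$ are $n$ empirical observations of a random variable $\xi$ with cumulative distribution function $P(\xi\le x)=\int_{-\infty}^x\int_{-\infty}^{\infty}f(s,u)m(u)\,du\,ds$. Here $f(\cdot,u)$ is the conditional density of $\xi$ given $\zeta=u$. $\mathbf{1}_A$ is the indicator function of a set $A$. The KS (Kolmogorov-Smirnov) distribution is the distribution, depending only on $n$, of $$D_n=\sup_{x\in\mathbb{R}}\left|\frac1n\sum_{i=1}^n\mathbf{1}_{(-\infty,x]}(\eta_i)-F(x)\right|,$$ where $\eta_1,\dots,\eta_n$ are independent real random variables, each distributed with the continuous cumulative distribution function $F$.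
   Formalization: The pairs (ζ_i, ξ_i) are assumed independent over i, as for independent observations; with only the ζ_i independent the claim fails, e.g. for ξ_1 = ξ_2 uniform and independent of the ζ_i. *)

theory Defs
  imports "HOL-Probability.Probability"
begin

text \<open>The density argument comes first, as in the notation \<open>f(s,u)\<close>: the function
  \<open>\<lambda>s. f s u\<close> is the density of \<open>\<xi>\<close> given \<open>\<zeta> = u\<close>, and \<open>cond_cdf f u\<close> is \<open>F\<^sub>u\<close>.\<close>

definition cond_cdf :: "(real \<Rightarrow> real \<Rightarrow> real) \<Rightarrow> real \<Rightarrow> real \<Rightarrow> real"
  where "cond_cdf f u x = (LINT s:{..x}|lborel. f s u)"

text \<open>\<open>P(X \<le> x | Z)\<close> as a random variable (determined only almost everywhere): the conditional
  expectation of the indicator of \<open>X \<le> x\<close> with respect to the sigma-algebra generated by \<open>Z\<close>.\<close>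

definition cond_prob_le :: "'a measure \<Rightarrow> ('a \<Rightarrow> real) \<Rightarrow> ('a \<Rightarrow> real) \<Rightarrow> real \<Rightarrow> 'a \<Rightarrow> real"
  where "cond_prob_le M X Z x =
    real_cond_exp M (vimage_algebra (space M) Z borel) (indicator {\<omega> \<in> space M. X \<omega> \<le> x})"

definition ks_statistic :: "nat \<Rightarrow> (real \<Rightarrow> real) \<Rightarrow> (nat \<Rightarrow> real) \<Rightarrow> real"
  where "ks_statistic n F y =
    (SUP x::real. \<bar>1 / real n * (\<Sum>i=1..n. indicator {..x} (y i)) - F x\<bar>)"

text \<open>A random variable is KS distributed (with sample size \<open>n\<close>) if its law is that of \<open>D\<^sub>n\<close>,
  for independent \<open>\<eta>\<^sub>1, \<dots>, \<eta>\<^sub>n\<close> with common law \<open>\<mu>\<close>; these are realised as the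
  coordinates of the product space.  Quantifying universally over the laws \<open>\<mu>\<close> with continuous
  distribution function makes the claim that the law of \<open>D\<^sub>n\<close> depends on \<open>n\<close> only part of
  being KS distributed.  Measurability is stated because \<open>distr\<close> is meaningless without it.\<close>

definition KS_distributed :: "'a measure \<Rightarrow> nat \<Rightarrow> ('a \<Rightarrow> real) \<Rightarrow> bool"
  where "KS_distributed M n S \<longleftrightarrow>
    S \<in> borel_measurable M \<and>
    (\<forall>\<mu>. real_distribution \<mu> \<and> continuous_on UNIV (cdf \<mu>) \<longrightarrow>
      distr M borel S = distr (\<Pi>\<^sub>M i\<in>{1..n}. \<mu>) borel (ks_statistic n (cdf \<mu>)))"

end

(* The conditional null hypothesis says that (\<zeta>_i, \<xi>_i) has density f(s, u) with respect to
   law(\<zeta>_i) x Lebesgue; it is enough to compare the two measures on the rectangles A x {..x}. Hence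
   for almost every u the conditional law of \<xi>_i is the one with continuous distribution function
   F_u, and the probability integral transform, applied for fixed u and then averaged over u, makes
   U_i = F_{\<zeta>_i}(\<xi>_i) uniform on [0,1]. The U_i are independent because the pairs are.
   On the other side, let F be any continuous distribution function. The values F(\<eta>_i) are
   independent and uniform as well, and almost surely no \<eta>_i lies beyond the left end of a flat piece
   of F, so that \<eta>_i \<le> x iff F(\<eta>_i) \<le> F(x) for all x simultaneously: D_n is the same function of
   uniform variables as S_n. *)

theory Submission
  imports Defs
begin

section \<open>The KS statistic as a measurable function of the sample\<close>

definition unif_cdf :: "real \<Rightarrow> real"
  where "unif_cdf t = max 0 (min 1 t)"

lemma continuous_on_unif_cdf: "continuous_on UNIV unif_cdf"
  unfolding unif_cdf_def by (intro continuous_intros)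

lemma unif_cdf_bounds: "0 \<le> unif_cdf t" "unif_cdf t \<le> 1"
  by (auto simp: unif_cdf_def)

lemma ks_bound:
  assumes "0 \<le> y" "y \<le> 1"
  shows "\<bar>1 / real n * (\<Sum>i=1..n. indicator {..x::real} (v i)) - y\<bar> \<le> 1"
proof -
  have "(\<Sum>i=1..n. indicator {..x} (v i) :: real) \<le> (\<Sum>i=1..n. 1)"
    by (intro sum_mono) (auto simp: indicator_def)
  then have "1 / real n * (\<Sum>i=1..n. indicator {..x} (v i)) \<le> 1"
    by (cases "n = 0") (auto simp: field_simps)
  moreover have "0 \<le> 1 / real n * (\<Sum>i=1..n. indicator {..x} (v i))"
    by (intro mult_nonneg_nonneg sum_nonneg) auto
  ultimately show ?thesis
    using assms by linarith
qed

lemma ks_bdd_above: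
  fixes F :: "real \<Rightarrow> real"
  assumes "\<And>x. 0 \<le> F x" "\<And>x. F x \<le> 1"
  shows "bdd_above ((\<lambda>x. \<bar>1 / real n * (\<Sum>i=1..n. indicator {..x} (v i)) - F x\<bar>) ` A)"
  using assms by (intro bdd_aboveI2[where M = 1] ks_bound)

lemma tendsto_indicator_atMost_at_right:
  "((\<lambda>y. indicator {..y} v :: real) \<longlongrightarrow> indicator {..x::real} v) (at_right x)"
proof (rule tendsto_eventually, cases "v \<le> x")
  case True
  then show "\<forall>\<^sub>F y in at_right x. indicator {..y} v = (indicator {..x} v :: real)"
    by (auto simp: eventually_at_right_field intro!: exI[of _ "x + 1"])
next
  case False
  then show "\<forall>\<^sub>F y in at_right x. indicator {..y} v = (indicator {..x} v :: real)"
    by (auto simp: eventually_at_right_field indicator_def intro!: exI[of _ v])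
qed

text \<open>Both \<open>F\<close> and the empirical distribution function are right-continuous, so
  the deviation at \<open>x\<close> is approximated at rationals to the right of \<open>x\<close>. A
  supremum over a countable set is what measurability needs.\<close>

lemma ks_statistic_eq_SUP_rat:
  assumes F: "continuous_on UNIV F" "\<And>x. 0 \<le> F x" "\<And>x. F x \<le> 1"
  shows "ks_statistic n F v =
    (SUP x\<in>\<rat>. \<bar>1 / real n * (\<Sum>i=1..n. indicator {..x} (v i)) - F x\<bar>)"
    (is "_ = (SUP x\<in>\<rat>. ?h x)")
  unfolding ks_statistic_def
proof (rule antisym)
  show "(SUP x. ?h x) \<le> (SUP x\<in>\<rat>. ?h x)"
  proof (rule cSUP_least)
    fix x :: real
    show "?h x \<le> (SUP x\<in>\<rat>. ?h x)"
    proof (rule ccontr)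
      assume *: "\<not> ?h x \<le> (SUP x\<in>\<rat>. ?h x)"
      have "(F \<longlongrightarrow> F x) (at_right x)"
        using F(1) by (simp add: continuous_on_eq_continuous_within
            continuous_within filterlim_at_split)
      then have "(?h \<longlongrightarrow> ?h x) (at_right x)"
        by (intro tendsto_intros tendsto_indicator_atMost_at_right)
      then have "\<forall>\<^sub>F y in at_right x. (SUP x\<in>\<rat>. ?h x) < ?h y"
        using * by (intro order_tendstoD) auto
      then obtain b where "x < b" and b: "\<And>y. x < y \<Longrightarrow> y < b \<Longrightarrow> (SUP x\<in>\<rat>. ?h x) < ?h y"
        by (auto simp: eventually_at_right_field)
      then obtain q where q: "q \<in> \<rat>" "x < q" "q < b"
        using Rats_dense_in_real by blast
      moreover have "?h q \<le> (SUP x\<in>\<rat>. ?h x)"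
        using q F by (intro cSUP_upper ks_bdd_above)
      ultimately show False
        using b by force
    qed
  qed simp
  show "(SUP x\<in>\<rat>. ?h x) \<le> (SUP x. ?h x)"
    using F by (intro cSUP_subset_mono ks_bdd_above) (auto intro: exI[of _ 0])
qed

lemma measurable_ks_statistic:
  assumes F: "continuous_on UNIV F" "\<And>x. 0 \<le> F x" "\<And>x. F x \<le> 1"
    and V[measurable]: "\<And>i. i \<in> {1..n} \<Longrightarrow> V i \<in> borel_measurable M"
  shows "(\<lambda>\<omega>. ks_statistic n F (\<lambda>i. V i \<omega>)) \<in> borel_measurable M"
  unfolding ks_statistic_eq_SUP_rat[OF F]
proof (rule borel_measurable_cSUP)
  show "(\<lambda>\<omega>. \<bar>1 / real n * (\<Sum>i=1..n. indicator {..x} (V i \<omega>)) - F x\<bar>) \<in> borel_measurable M" for x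
    by measurable
  show "bdd_above ((\<lambda>x. \<bar>1 / real n * (\<Sum>i=1..n. indicator {..x} (V i \<omega>)) - F x\<bar>) ` \<rat>)" for \<omega>
    by (intro ks_bdd_above F)
qed (rule countable_rat)

section \<open>The probability integral transform\<close>

context real_distribution
begin

lemma cdf_ge_above:
  assumes "y < 1" shows "\<exists>b. y \<le> cdf M b"
proof -
  have "\<forall>\<^sub>F x in at_top. y < cdf M x"
    using cdf_lim_at_top_prob assms by (rule order_tendstoD)
  then show ?thesis
    by (metis eventually_happens less_imp_le trivial_limit_at_top_linorder)
qed

lemma cdf_le_below:
  assumes "0 < y" shows "\<exists>a. cdf M a \<le> y"
proof -
  have "\<forall>\<^sub>F x in at_bot. cdf M x < y"
    using cdf_lim_at_bot assms by (rule order_tendstoD)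
  then show ?thesis
    by (metis eventually_happens less_imp_le trivial_limit_at_bot_linorder)
qed

lemma cdf_surj:
  assumes cont: "continuous_on UNIV (cdf M)" and "0 < t" "t < 1"
  obtains x where "cdf M x = t"
proof -
  obtain a b where ab: "cdf M a \<le> t" "t \<le> cdf M b"
    using cdf_ge_above cdf_le_below assms by blast
  then have "\<exists>x. cdf M x = t"
  proof (cases "a \<le> b")
    case True
    then show ?thesis
      using IVT'[of "cdf M" a t b] ab continuous_on_subset[OF cont] by blast
  next
    case False
    \<comment> \<open>With \<open>b < a\<close>, monotonicity gives
      \<open>t \<le> cdf M b \<le> cdf M a \<le> t\<close>.\<close>
    then show ?thesis
      using ab cdf_nondecreasing[of b a] by (intro exI[of _ a]) simp
  qed
  then show ?thesis
    using that by blast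
qed

lemma measurable_cdf [measurable]: "cdf M \<in> borel_measurable borel"
  by (intro borel_measurable_mono monoI cdf_nondecreasing)

text \<open>For \<open>0 < t < 1\<close> the sublevel set is a closed half-line, by monotonicity and
  continuity, and \<open>cdf M\<close> equals \<open>t\<close> at its right end. Level 0 is squeezed
  from above by small positive levels; the remaining levels are trivial.\<close>

lemma cdf_probability_integral_transform:
  assumes cont: "continuous_on UNIV (cdf M)"
  shows "prob {s. cdf M s \<le> t} = unif_cdf t"
proof -
  have mid: "prob {s. cdf M s \<le> t} = t" if t: "0 < t" "t < 1" for t
  proof -
    let ?S = "{s. cdf M s \<le> t}"
    obtain x where x: "cdf M x = t"
      using cdf_surj[OF cont t] .
    \<comment> \<open>The midpoint of \<open>t\<close> and 1 exceeds \<open>t\<close>, so no point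
      from \<open>b\<close> onwards lies in the sublevel set, which is therefore bounded
      above.\<close>
    obtain b where b: "(t + 1) / 2 \<le> cdf M b"
      using cdf_ge_above[of "(t + 1) / 2"] t by auto
    have "bdd_above ?S"
    proof (rule bdd_aboveI)
      fix s assume "s \<in> ?S"
      then have "\<not> b \<le> s"
        using b t cdf_nondecreasing[of b s] by (auto simp: field_simps)
      then show "s \<le> b" by simp
    qed
    moreover have "closed ?S"
      using cont by (intro closed_Collect_le continuous_intros)
    ultimately have Sup: "Sup ?S \<in> ?S" "\<And>s. s \<in> ?S \<Longrightarrow> s \<le> Sup ?S"
      using x closed_contains_Sup[of ?S] cSup_upper[of _ ?S] by auto
    have "cdf M s \<le> t" if "s \<le> Sup ?S" for s
      using cdf_nondecreasing[OF that] Sup(1) by simp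
    with Sup have "?S = {..Sup ?S}" by blast
    then have "prob ?S = cdf M (Sup ?S)"
      by (simp add: cdf_def2)
    also have "\<dots> = t"
      using Sup x cdf_nondecreasing[of x "Sup ?S"] by force
    finally show ?thesis .
  qed
  consider "t < 0" | "t = 0" | "0 < t" "t < 1" | "1 \<le> t" by linarith
  then show ?thesis
  proof cases
    case 1
    then have "{s. cdf M s \<le> t} = {}"
      using cdf_nonneg by (auto simp: not_le intro: less_le_trans)
    with 1 show ?thesis by (simp add: unif_cdf_def)
  next
    case 2
    have "prob {s. cdf M s \<le> 0} \<le> 0 + e" if "0 < e" for e
    proof -
      \<comment> \<open>The cap at 1/2 keeps the level strictly between 0 and 1, where
        \<open>mid\<close> applies.\<close>
      have "prob {s. cdf M s \<le> 0} \<le> prob {s. cdf M s \<le> min e (1/2)}"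
        using that by (intro finite_measure_mono) auto
      then show ?thesis
        using mid[of "min e (1/2)"] that by auto
    qed
    then have "prob {s. cdf M s \<le> 0} \<le> 0"
      by (rule field_le_epsilon)
    with 2 show ?thesis
      by (simp add: unif_cdf_def measure_le_0_iff)
  next
    case 3
    then show ?thesis by (simp add: mid unif_cdf_def)
  next
    case 4
    then have "{s. cdf M s \<le> t} = UNIV"
      using cdf_bounded_prob order_trans by blast
    with 4 show ?thesis
      using prob_space by (simp add: unif_cdf_def)
  qed
qed

lemma cdf_distr_cdf:
  assumes "continuous_on UNIV (cdf M)"
  shows "cdf (distr M borel (cdf M)) = unif_cdf"
proof
  fix t
  have "cdf (distr M borel (cdf M)) t = prob {s. cdf M s \<le> t}"
    by (simp add: cdf_def[of "distr _ _ _"] measure_distr vimage_def)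
  then show "cdf (distr M borel (cdf M)) t = unif_cdf t"
    using cdf_probability_integral_transform[OF assms] by simp
qed

text \<open>Level 0 need not be attained by \<open>cdf M\<close>. There the empirical distribution
  function of the transformed sample vanishes provided that no transformed value is 0.\<close>

lemma AE_cdf_pos:
  assumes "continuous_on UNIV (cdf M)"
  shows "AE s in M. 0 < cdf M s"
proof -
  have "prob {s. cdf M s \<le> 0} = 0"
    using cdf_probability_integral_transform[OF assms, of 0] by (simp add: unif_cdf_def)
  then show ?thesis
    by (intro AE_I[of _ _ "{s. cdf M s \<le> 0}"]) (auto simp: emeasure_eq_measure)
qed

text \<open>For fixed \<open>q\<close>, the event \<open>cdf M s \<le> cdf M q\<close> contains
  \<open>s \<le> q\<close>, and both have probability \<open>cdf M q\<close> by the integral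
  transform, so their difference is null. Rational \<open>q\<close> suffice for one null set that
  serves all \<open>x\<close>, since a failure at \<open>x\<close> gives a failure at every
  \<open>q\<close> between \<open>x\<close> and \<open>s\<close>.\<close>

lemma AE_cdf_le_cdf_imp_le:
  assumes cont: "continuous_on UNIV (cdf M)"
  shows "AE s in M. \<forall>x. cdf M s \<le> cdf M x \<longrightarrow> s \<le> x"
proof -
  have "AE s in M. cdf M s \<le> cdf M q \<longrightarrow> s \<le> q" for q
  proof -
    have "prob ({s. cdf M s \<le> cdf M q} - {..q}) = prob {s. cdf M s \<le> cdf M q} - prob {..q}"
      using cdf_nondecreasing by (intro finite_measure_Diff) auto
    also have "\<dots> = 0"
      using cdf_probability_integral_transform[OF cont] cdf_nonneg[of q] cdf_bounded_prob[of q]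
      by (simp add: unif_cdf_def cdf_def2)
    finally show ?thesis
      by (intro AE_I[of _ _ "{s. cdf M s \<le> cdf M q} - {..q}"]) (auto simp: emeasure_eq_measure)
  qed
  then have "AE s in M. \<forall>q\<in>\<rat>. cdf M s \<le> cdf M q \<longrightarrow> s \<le> q"
    by (simp add: AE_ball_countable countable_rat)
  then show ?thesis
  proof (rule AE_mp, intro AE_I2 impI allI)
    fix s x assume *: "\<forall>q\<in>\<rat>. cdf M s \<le> cdf M q \<longrightarrow> s \<le> q" "cdf M s \<le> cdf M x"
    show "s \<le> x"
    proof (rule ccontr)
      assume "\<not> s \<le> x"
      then obtain q where q: "q \<in> \<rat>" "x < q" "q < s"
        using Rats_dense_in_real[of x s] by auto
      then have "cdf M s \<le> cdf M q"
        using *(2) cdf_nondecreasing[of x q] by simp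
      with q * show False by force
    qed
  qed
qed

section \<open>Distribution-freeness of the KS statistic\<close>

text \<open>Substitute the level \<open>t = cdf M x\<close>. By \<open>le\<close> and monotonicity,
  \<open>v i \<le> x\<close> holds iff \<open>cdf M (v i) \<le> cdf M x\<close>, so the deviation at
  \<open>x\<close> is the uniform deviation \<open>h\<close> at level \<open>cdf M x\<close>. All
  levels strictly between 0 and 1 are attained, and \<open>h\<close> vanishes at the others, so the
  two suprema agree.\<close>

lemma ks_statistic_cdf:
  assumes cont: "continuous_on UNIV (cdf M)" and "n \<ge> 1"
    and pos: "\<And>i. i \<in> {1..n} \<Longrightarrow> 0 < cdf M (v i)"
    and le: "\<And>i x. i \<in> {1..n} \<Longrightarrow> cdf M (v i) \<le> cdf M x \<Longrightarrow> v i \<le> x"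
  shows "ks_statistic n (cdf M) v = ks_statistic n unif_cdf (\<lambda>i. cdf M (v i))"
proof -
  define h where "h t = \<bar>1 / real n * (\<Sum>i=1..n. indicator {..t} (cdf M (v i))) - unif_cdf t\<bar>" for t
  have bdd: "bdd_above (h ` A)" for A
    unfolding h_def by (intro ks_bdd_above unif_cdf_bounds)
  have outside: "h t = 0" if "t \<le> 0 \<or> 1 \<le> t" for t
  proof -
    from that consider "t \<le> 0" | "1 \<le> t" by blast
    then show ?thesis
    proof cases
      case 1
      then have "(\<Sum>i=1..n. indicator {..t} (cdf M (v i)) :: real) = 0"
        using pos by (intro sum.neutral) (force simp: indicator_def)
      with 1 show ?thesis by (simp add: h_def unif_cdf_def)
    next
      case 2
      then have "(\<Sum>i=1..n. indicator {..t} (cdf M (v i)) :: real) = (\<Sum>i=1..n. 1)"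
        using order_trans[OF cdf_bounded_prob] by (intro sum.cong) (auto simp: indicator_def)
      with 2 \<open>n \<ge> 1\<close> show ?thesis by (simp add: h_def unif_cdf_def)
    qed
  qed
  have h_cdf: "\<bar>1 / real n * (\<Sum>i=1..n. indicator {..x} (v i)) - cdf M x\<bar> = h (cdf M x)" for x
  proof -
    have "(\<Sum>i=1..n. indicator {..x} (v i) :: real) = (\<Sum>i=1..n. indicator {..cdf M x} (cdf M (v i)))"
      using le cdf_nondecreasing by (intro sum.cong) (auto simp: indicator_def)
    then show ?thesis
      using cdf_nonneg[of x] cdf_bounded_prob[of x] by (simp add: h_def unif_cdf_def)
  qed
  have "(SUP x. h (cdf M x)) = (SUP t. h t)"
  proof (rule antisym)
    show "(SUP x. h (cdf M x)) \<le> (SUP t. h t)"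
      by (intro cSUP_least cSUP_upper bdd) auto
    have upper: "h (cdf M x) \<le> (SUP x. h (cdf M x))" for x
      using bdd[of "range (cdf M)"] by (intro cSUP_upper) (auto simp: image_image)
    show "(SUP t. h t) \<le> (SUP x. h (cdf M x))"
    proof (rule cSUP_least)
      fix t
      show "h t \<le> (SUP x. h (cdf M x))"
      proof (cases "t \<le> 0 \<or> 1 \<le> t")
        case True
        then have "h t \<le> h (cdf M 0)"
          by (simp add: outside) (simp add: h_def)
        also note upper
        finally show ?thesis .
      next
        case False
        then obtain x where "cdf M x = t"
          using cdf_surj[OF cont, of t] by auto
        then show ?thesis
          using upper by blast
      qed
    qed simp
  qed
  then show ?thesis
    unfolding ks_statistic_def h_cdf by (simp add: h_def)
qed

text \<open>The right-hand side depends on \<open>M\<close> only through the law of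
  \<open>cdf M\<close>, which is uniform; this is why the law of D_n depends on \<open>n\<close>
  alone. The conditions of the pointwise identity hold almost surely in each of the finitely many
  coordinates, hence almost surely in the product.\<close>

lemma distr_ks_statistic:
  assumes cont: "continuous_on UNIV (cdf M)" and "n \<ge> 1"
  shows "distr (\<Pi>\<^sub>M i\<in>{1..n}. M) borel (ks_statistic n (cdf M)) =
    distr (\<Pi>\<^sub>M i\<in>{1..n}. distr M borel (cdf M)) borel (ks_statistic n unif_cdf)"
proof -
  let ?P = "\<Pi>\<^sub>M i\<in>{1..n}. M"
  have ks_unif: "ks_statistic n unif_cdf \<in> borel_measurable (\<Pi>\<^sub>M i\<in>{1..n}. borel)"
    by (rule measurable_ks_statistic[OF continuous_on_unif_cdf unif_cdf_bounds]) measurable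
  have comp: "compose {1..n} (cdf M) \<in> ?P \<rightarrow>\<^sub>M (\<Pi>\<^sub>M i\<in>{1..n}. borel)"
    unfolding compose_def by measurable
  have "AE s in M. 0 < cdf M s \<and> (\<forall>x. cdf M s \<le> cdf M x \<longrightarrow> s \<le> x)"
    using AE_cdf_pos[OF cont] AE_cdf_le_cdf_imp_le[OF cont] by simp
  then have "AE v in ?P. 0 < cdf M (v i) \<and> (\<forall>x. cdf M (v i) \<le> cdf M x \<longrightarrow> v i \<le> x)"
    if "i \<in> {1..n}" for i
    using that by (intro AE_PiM_component prob_space_axioms)
  then have "AE v in ?P. \<forall>i\<in>{1..n}. 0 < cdf M (v i) \<and> (\<forall>x. cdf M (v i) \<le> cdf M x \<longrightarrow> v i \<le> x)"
    by (intro AE_finite_allI) auto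
  then have ae: "AE v in ?P. ks_statistic n (cdf M) v = ks_statistic n unif_cdf (compose {1..n} (cdf M) v)"
  proof (rule AE_mp, intro AE_I2 impI)
    fix v assume v: "\<forall>i\<in>{1..n}. 0 < cdf M (v i) \<and> (\<forall>x. cdf M (v i) \<le> cdf M x \<longrightarrow> v i \<le> x)"
    then have "ks_statistic n (cdf M) v = ks_statistic n unif_cdf (\<lambda>i. cdf M (v i))"
      by (intro ks_statistic_cdf[OF cont \<open>n \<ge> 1\<close>]) auto
    \<comment> \<open>\<open>compose\<close> is \<open>undefined\<close> outside
      \<open>{1..n}\<close>, where the statistic does not look.\<close>
    also have "\<dots> = ks_statistic n unif_cdf (compose {1..n} (cdf M) v)"
      by (simp add: ks_statistic_def compose_def)
    finally show "ks_statistic n (cdf M) v = ks_statistic n unif_cdf (compose {1..n} (cdf M) v)" .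
  qed
  have "distr ?P borel (ks_statistic n (cdf M)) =
      distr ?P borel (\<lambda>v. ks_statistic n unif_cdf (compose {1..n} (cdf M) v))"
  proof (rule distr_cong_AE[OF refl refl ae])
    show "ks_statistic n (cdf M) \<in> borel_measurable ?P"
      by (rule measurable_ks_statistic[OF cont cdf_nonneg cdf_bounded_prob]) measurable
    show "(\<lambda>v. ks_statistic n unif_cdf (compose {1..n} (cdf M) v)) \<in> borel_measurable ?P"
      using measurable_compose[OF comp ks_unif] .
  qed
  also have "\<dots> = distr (distr ?P (\<Pi>\<^sub>M i\<in>{1..n}. borel) (compose {1..n} (cdf M))) borel (ks_statistic n unif_cdf)"
    using distr_distr[OF ks_unif comp] by (simp add: o_def)
  also have "distr ?P (\<Pi>\<^sub>M i\<in>{1..n}. borel) (compose {1..n} (cdf M)) = (\<Pi>\<^sub>M i\<in>{1..n}. distr M borel (cdf M))"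
  proof -
    \<comment> \<open>\<open>distr\<close> uses only the space and sigma-algebra of its target;
      those of \<open>M\<close> are the Borel ones, so \<open>M\<close> can stand in for
      \<open>borel\<close>.\<close>
    have "distr ?P (\<Pi>\<^sub>M i\<in>{1..n}. borel) (compose {1..n} (cdf M)) = distr ?P ?P (compose {1..n} (cdf M))"
      by (intro distr_cong refl sets_PiM_cong) simp_all
    also have "\<dots> = (\<Pi>\<^sub>M i\<in>{1..n}. distr M M (cdf M))"
      by (intro distr_PiM_finite_prob_space' prob_space_axioms) auto
    also have "distr M M (cdf M) = distr M borel (cdf M)"
      by (intro distr_cong refl) simp_all
    finally show ?thesis .
  qed
  finally show ?thesis .
qed

end

section \<open>Equality of measures on the plane from rectangles\<close>

lemma sets_borel_atMost: "sets borel = sigma_sets UNIV (range (atMost :: real \<Rightarrow> real set))"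
  by (subst borel_eq_atMost) (simp add: sets_measure_of)

lemma UN_atMost_real_of_nat: "(\<Union>k. {..real k}) = UNIV"
  using real_arch_simple by auto

text \<open>Generating the product sigma-algebra by rectangles of generators takes countable covers
  of both factors by generators: \<open>UNIV\<close> alone on the left, the half-lines
  \<open>{..real k}\<close> on the right.\<close>

lemma sets_borel_pair_Times_atMost:
  "sets (borel \<Otimes>\<^sub>M borel) =
    sigma_sets UNIV {a \<times> b | (a :: real set) (b :: real set). a \<in> sets borel \<and> b \<in> range atMost}"
proof -
  have 1: "sets borel \<subseteq> Pow (space borel :: real set)" by simp
  have 2: "sets borel = sigma_sets (space borel :: real set) (sets borel)"
    by (rule sets.sigma_sets_eq[symmetric])
  have 3: "countable {UNIV :: real set}" "{UNIV :: real set} \<subseteq> sets borel" "\<Union>{UNIV :: real set} = space borel"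
    by auto
  have 4: "range (atMost :: real \<Rightarrow> real set) \<subseteq> Pow (space borel)" by auto
  have 5: "sets borel = sigma_sets (space borel) (range (atMost :: real \<Rightarrow> real set))"
    using sets_borel_atMost by simp
  have 6: "countable (range (\<lambda>k. {..real k}))" "range (\<lambda>k. {..real k}) \<subseteq> range (atMost :: real \<Rightarrow> real set)"
    "\<Union>(range (\<lambda>k. {..real k})) = space borel"
    using UN_atMost_real_of_nat by auto
  show ?thesis
    unfolding sets_pair_eq[OF 1 2 3 4 5 6] by (subst sets_measure_of) auto
qed

text \<open>Uniqueness on an intersection-stable generator, exhausted by the strips
  \<open>UNIV \<times> {..real k}\<close>. Finiteness is asked of one measure only, so that the
  other can be a density not yet known to have total mass 1.\<close>

lemma measure_eqI_Times_atMost: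
  fixes M N :: "(real \<times> real) measure"
  assumes "sets M = sets (borel \<Otimes>\<^sub>M borel)" "sets N = sets (borel \<Otimes>\<^sub>M borel)" and fin: "finite_measure M"
    and eq: "\<And>A x. A \<in> sets borel \<Longrightarrow> emeasure M (A \<times> {..x}) = emeasure N (A \<times> {..x})"
  shows "M = N"
proof (rule measure_eqI_generator_eq)
  let ?E = "{a \<times> b | (a :: real set) (b :: real set). a \<in> sets borel \<and> b \<in> range atMost}"
  show "Int_stable ?E"
  proof (rule Int_stableI)
    fix a b assume "a \<in> ?E" "b \<in> ?E"
    then obtain A x B y where "a = A \<times> {..x}" "b = B \<times> {..y}" "A \<in> sets borel" "B \<in> sets borel"
      by auto
    then have "a \<inter> b = (A \<inter> B) \<times> {..min x y}" "A \<inter> B \<in> sets borel"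
      by auto
    then show "a \<inter> b \<in> ?E" by blast
  qed
  show "?E \<subseteq> Pow UNIV"
    by simp
  show "emeasure M C = emeasure N C" if "C \<in> ?E" for C
    using that eq by auto
  show "sets M = sigma_sets UNIV ?E" "sets N = sigma_sets UNIV ?E"
    unfolding assms by (rule sets_borel_pair_Times_atMost)+
  show "range (\<lambda>k. UNIV \<times> {..real k}) \<subseteq> ?E"
  proof (rule image_subsetI)
    fix k
    have "(UNIV :: real set) \<in> sets borel" by simp
    then show "UNIV \<times> {..real k} \<in> ?E" by blast
  qed
  show "(\<Union>k. UNIV \<times> {..real k}) = UNIV"
    by (auto intro: real_arch_simple)
  show "emeasure M (UNIV \<times> {..real k}) \<noteq> \<infinity>" for k
    using finite_measure.emeasure_finite[OF fin] by simp
qed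

section \<open>Densities and the functions \<open>cond_cdf f u\<close>\<close>

lemma cond_cdf_nonneg:
  assumes "\<And>s u. f s u \<ge> 0"
  shows "0 \<le> cond_cdf f u x"
  unfolding cond_cdf_def set_lebesgue_integral_def
  using assms by (intro Bochner_Integration.integral_nonneg) (auto simp: indicator_def)

lemma borel_measurable_section:
  fixes f :: "real \<Rightarrow> real \<Rightarrow> real"
  assumes "(\<lambda>(s, u). f s u) \<in> borel_measurable (borel \<Otimes>\<^sub>M borel)"
  shows "(\<lambda>s. f s u) \<in> borel_measurable borel"
proof -
  have "(\<lambda>s. (s, u)) \<in> borel \<rightarrow>\<^sub>M borel \<Otimes>\<^sub>M borel"
    by measurable
  from measurable_compose[OF this assms] show ?thesis
    by simp
qed

text \<open>Joint measurability permits random arguments in both places, as in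
  \<open>cond_cdf f (Z \<omega>) (X \<omega>)\<close>.\<close>

lemma measurable_cond_cdf:
  assumes [measurable]: "(\<lambda>(s, u). f s u) \<in> borel_measurable (borel \<Otimes>\<^sub>M borel)"
  shows "(\<lambda>(u, x). cond_cdf f u x) \<in> borel_measurable (borel \<Otimes>\<^sub>M borel)"
proof -
  have [measurable]: "(\<lambda>p. f (snd p) (fst (fst p))) \<in> borel_measurable ((borel \<Otimes>\<^sub>M borel) \<Otimes>\<^sub>M lborel)"
    using measurable_compose[where f = "\<lambda>p. (snd p, fst (fst p))", OF _ assms] by simp
  show ?thesis
    unfolding cond_cdf_def set_lebesgue_integral_def split_beta' indicator_def of_bool_def atMost_iff
    by measurable
qed

lemma nn_integral_atMost_eq_cond_cdf:
  assumes "\<And>s u. f s u \<ge> 0" and "set_integrable lborel {..x} (\<lambda>s. f s u)"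
  shows "(\<integral>\<^sup>+s\<in>{..x}. f s u \<partial>lborel) = ennreal (cond_cdf f u x)"
proof -
  have "(\<integral>\<^sup>+s\<in>{..x}. f s u \<partial>lborel) = (\<integral>\<^sup>+s. ennreal (indicator {..x} s *\<^sub>R f s u) \<partial>lborel)"
    by (intro nn_integral_cong) (auto simp: indicator_def)
  also have "\<dots> = ennreal (cond_cdf f u x)"
    using assms unfolding cond_cdf_def set_lebesgue_integral_def set_integrable_def
    by (intro nn_integral_eq_integral) (auto simp: indicator_def)
  finally show ?thesis .
qed

lemma set_integrable_if_cond_cdf_neq_0:
  assumes "cond_cdf f u x \<noteq> 0"
  shows "set_integrable lborel {..x} (\<lambda>s. f s u)"
  using assms not_integrable_integral_eq
  unfolding cond_cdf_def set_lebesgue_integral_def set_integrable_def by blast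

text \<open>Where \<open>f(\<cdot>, u)\<close> is not integrable on \<open>{..x}\<close>, the Bochner integral makes \<open>cond_cdf f u x\<close> zero,
  so that \<open>f(\<cdot>, u)\<close> is a probability density has to be extracted from the limit at infinity.\<close>

lemma nn_integral_density_eq_1:
  fixes f :: "real \<Rightarrow> real \<Rightarrow> real"
  assumes f: "\<And>s u. f s u \<ge> 0"
    and [measurable]: "(\<lambda>s. f s u) \<in> borel_measurable borel"
    and inc: "incseq (\<lambda>k::nat. cond_cdf f u (real k))"
    and sup: "(SUP k::nat. ennreal (cond_cdf f u (real k))) = 1"
  shows "(\<integral>\<^sup>+s. f s u \<partial>lborel) = 1"
proof -
  have "\<exists>K::nat. cond_cdf f u (real K) \<noteq> 0"
  proof (rule ccontr)
    assume "\<not> ?thesis"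
    with sup show False by simp
  qed
  then obtain K :: nat where K: "cond_cdf f u (real K) \<noteq> 0" by blast
  \<comment> \<open>The nonzero value at \<open>K\<close> persists for larger arguments by
    monotonicity, and a nonzero Bochner integral forces integrability; smaller arguments are reached
    by restriction from \<open>max k K\<close>.\<close>
  have int: "set_integrable lborel {..real k} (\<lambda>s. f s u)" for k :: nat
  proof -
    have "0 < cond_cdf f u (real K)"
      using K cond_cdf_nonneg[of f u "real K"] f by simp
    also have "\<dots> \<le> cond_cdf f u (real (max k K))"
      using inc by (simp add: incseq_def)
    finally have "set_integrable lborel {..real (max k K)} (\<lambda>s. f s u)"
      by (intro set_integrable_if_cond_cdf_neq_0) simp
    then show ?thesis
      by (rule set_integrable_subset) auto
  qed
  have "(\<integral>\<^sup>+s. f s u \<partial>lborel) = (\<integral>\<^sup>+s. (SUP k::nat. ennreal (f s u) * indicator {..real k} s) \<partial>lborel)"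
  proof (intro nn_integral_cong antisym)
    fix s
    obtain k :: nat where "s \<le> real k"
      using real_arch_simple by blast
    then show "ennreal (f s u) \<le> (SUP k::nat. ennreal (f s u) * indicator {..real k} s)"
      by (intro SUP_upper2[of k]) auto
    show "(SUP k::nat. ennreal (f s u) * indicator {..real k} s) \<le> ennreal (f s u)"
      by (intro SUP_least) (auto simp: indicator_def)
  qed
  also have "\<dots> = (SUP k::nat. \<integral>\<^sup>+s\<in>{..real k}. f s u \<partial>lborel)"
    by (intro nn_integral_monotone_convergence_SUP)
      (auto simp: incseq_def le_fun_def indicator_def)
  also have "\<dots> = 1"
    unfolding nn_integral_atMost_eq_cond_cdf[where f = f and u = u, OF f int] by (rule sup)
  finally show ?thesis .
qed

context
  fixes f :: "real \<Rightarrow> real \<Rightarrow> real" and u :: real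
  assumes f: "\<And>s u. f s u \<ge> 0"
    and [measurable]: "(\<lambda>s. f s u) \<in> borel_measurable borel"
    and one: "(\<integral>\<^sup>+s. f s u \<partial>lborel) = 1"
begin

lemma real_distribution_density: "real_distribution (density lborel (\<lambda>s. f s u))"
proof -
  have "prob_space (density lborel (\<lambda>s. f s u))"
    using one by (intro prob_spaceI) (simp add: emeasure_density)
  then show ?thesis
    by (simp add: real_distribution_def real_distribution_axioms_def)
qed

interpretation D: real_distribution "density lborel (\<lambda>s. f s u)"
  by (rule real_distribution_density)

lemma cdf_density: "cdf (density lborel (\<lambda>s. f s u)) = cond_cdf f u"
proof
  fix x
  have "integrable lborel (\<lambda>s. f s u)"
    using f one by (intro integrableI_nn_integral_finite[where x = 1]) auto
  then have "set_integrable lborel {..x} (\<lambda>s. f s u)"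
    unfolding set_integrable_def by (intro integrable_mult_indicator) auto
  then show "cdf (density lborel (\<lambda>s. f s u)) x = cond_cdf f u x"
    using nn_integral_atMost_eq_cond_cdf[where f = f and x = x and u = u, OF f]
    by (simp add: cdf_def measure_def emeasure_density cond_cdf_nonneg f)
qed

lemma emeasure_density_atMost:
  "emeasure (density lborel (\<lambda>s. f s u)) {..x} = ennreal (cond_cdf f u x)"
  unfolding cdf_density[symmetric] cdf_def2 by (rule D.emeasure_eq_measure)

text \<open>A density with respect to Lebesgue measure leaves no mass on single points.\<close>

lemma continuous_on_cdf_density: "continuous_on UNIV (cdf (density lborel (\<lambda>s. f s u)))"
proof -
  have "emeasure (density lborel (\<lambda>s. f s u)) {x} = 0" for x
    by (simp add: emeasure_density)
  then show ?thesis
    by (intro continuous_at_imp_continuous_on ballI) (simp add: D.isCont_cdf measure_def)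
qed

end

section \<open>Conditional probabilities and the joint law of the pair\<close>

context prob_space
begin

context
  fixes X Z :: "'a \<Rightarrow> real"
  assumes [measurable]: "X \<in> borel_measurable M" "Z \<in> borel_measurable M"
begin

interpretation finite_measure_subalgebra M "vimage_algebra (space M) Z borel"
proof unfold_locales
  show "subalgebra M (vimage_algebra (space M) Z borel)"
    unfolding subalgebra_def by (simp add: sets_image_in_sets)
qed

lemma integrable_indicator_le: "integrable M (indicator {\<omega> \<in> space M. X \<omega> \<le> x} :: 'a \<Rightarrow> real)"
proof (rule integrable_real_indicator)
  show "{\<omega> \<in> space M. X \<omega> \<le> x} \<in> sets M" by measurable
qed (simp add: emeasure_eq_measure)

lemma AE_cond_prob_le_nonneg: "AE \<omega> in M. 0 \<le> cond_prob_le M X Z x \<omega>"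
  unfolding cond_prob_le_def by (rule real_cond_exp_ge_c[OF integrable_indicator_le]) simp

lemma AE_cond_prob_le_le_1: "AE \<omega> in M. cond_prob_le M X Z x \<omega> \<le> 1"
  unfolding cond_prob_le_def by (rule real_cond_exp_le_c[OF integrable_indicator_le]) (simp add: indicator_def)

lemma AE_cond_prob_le_mono:
  assumes "x \<le> y" shows "AE \<omega> in M. cond_prob_le M X Z x \<omega> \<le> cond_prob_le M X Z y \<omega>"
  unfolding cond_prob_le_def
proof (rule real_cond_exp_mono[OF _ integrable_indicator_le integrable_indicator_le])
  show "AE \<omega> in M. indicator {\<omega> \<in> space M. X \<omega> \<le> x} \<omega> \<le> (indicator {\<omega> \<in> space M. X \<omega> \<le> y} \<omega> :: real)"
    using assms by (intro AE_I2) (simp add: indicator_def)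
qed

text \<open>The indicator of \<open>Z \<omega> \<in> A\<close> is measurable for the sigma-algebra
  generated by \<open>Z\<close>, so this is the defining averaging property of conditional
  expectation.\<close>

lemma nn_integral_cond_prob_le:
  assumes A: "A \<in> sets borel"
  shows "(\<integral>\<^sup>+\<omega>. ennreal (cond_prob_le M X Z x \<omega>) * indicator A (Z \<omega>) \<partial>M) =
    emeasure M {\<omega> \<in> space M. Z \<omega> \<in> A \<and> X \<omega> \<le> x}"
proof -
  let ?I = "indicator {\<omega> \<in> space M. X \<omega> \<le> x} :: 'a \<Rightarrow> real"
  have "Z \<in> vimage_algebra (space M) Z borel \<rightarrow>\<^sub>M borel"
    by (rule measurable_vimage_algebra1) auto
  then have A1: "(\<lambda>\<omega>. indicator A (Z \<omega>) :: real) \<in> borel_measurable (vimage_algebra (space M) Z borel)"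
    by (rule measurable_compose) (rule borel_measurable_indicator[OF A])
  have I: "?I \<in> borel_measurable M"
    using integrable_indicator_le by (rule borel_measurable_integrable)
  have prod: "indicator A (Z \<omega>) * ?I \<omega> = indicator {\<omega> \<in> space M. Z \<omega> \<in> A \<and> X \<omega> \<le> x} \<omega>"
    if "\<omega> \<in> space M" for \<omega>
    using that by (auto simp: indicator_def)
  have S: "{\<omega> \<in> space M. Z \<omega> \<in> A \<and> X \<omega> \<le> x} \<in> sets M"
    using A by measurable
  let ?S = "{\<omega> \<in> space M. Z \<omega> \<in> A \<and> X \<omega> \<le> x}"
  have "integrable M (indicator ?S :: 'a \<Rightarrow> real)"
    using S by (intro integrable_real_indicator) (auto simp: emeasure_eq_measure)
  moreover have "integrable M (\<lambda>\<omega>. indicator A (Z \<omega>) * ?I \<omega>) \<longleftrightarrow> integrable M (indicator ?S :: 'a \<Rightarrow> real)"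
    by (intro Bochner_Integration.integrable_cong refl prod)
  ultimately have int: "integrable M (\<lambda>\<omega>. indicator A (Z \<omega>) * ?I \<omega>)"
    by simp
  note * = real_cond_exp_intg[OF int A1 I]
  have "(\<integral>\<^sup>+\<omega>. ennreal (cond_prob_le M X Z x \<omega>) * indicator A (Z \<omega>) \<partial>M) =
      (\<integral>\<^sup>+\<omega>. ennreal (indicator A (Z \<omega>) * cond_prob_le M X Z x \<omega>) \<partial>M)"
    by (intro nn_integral_cong) (auto simp: indicator_def)
  also have "\<dots> = ennreal (\<integral>\<omega>. indicator A (Z \<omega>) * cond_prob_le M X Z x \<omega> \<partial>M)"
  proof (rule nn_integral_eq_integral)
    show "integrable M (\<lambda>\<omega>. indicator A (Z \<omega>) * cond_prob_le M X Z x \<omega>)"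
      unfolding cond_prob_le_def by (rule *(1))
    show "AE \<omega> in M. 0 \<le> indicator A (Z \<omega>) * cond_prob_le M X Z x \<omega>"
      using AE_cond_prob_le_nonneg[of x] by eventually_elim simp
  qed
  also have "(\<integral>\<omega>. indicator A (Z \<omega>) * cond_prob_le M X Z x \<omega> \<partial>M) = (\<integral>\<omega>. indicator A (Z \<omega>) * ?I \<omega> \<partial>M)"
    unfolding cond_prob_le_def by (rule *(2))
  also have "\<dots> = (\<integral>\<omega>. indicator ?S \<omega> \<partial>M)"
    by (intro Bochner_Integration.integral_cong refl prod)
  also have "\<dots> = measure M ?S"
    by (simp add: Collect_conj_eq Int_assoc Int_commute)
  finally show ?thesis
    by (simp add: emeasure_eq_measure)
qed

context
  fixes f :: "real \<Rightarrow> real \<Rightarrow> real"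
  assumes f_meas[measurable]: "(\<lambda>(s, u). f s u) \<in> borel_measurable (borel \<Otimes>\<^sub>M borel)"
    and f_nonneg: "\<And>s u. f s u \<ge> 0"
    and null: "\<And>x. AE \<omega> in M. cond_prob_le M X Z x \<omega> = cond_cdf f (Z \<omega>) x"
begin

lemma measurable_cond_cdf_Z: "(\<lambda>\<omega>. cond_cdf f (Z \<omega>) x) \<in> borel_measurable M"
proof -
  have "(\<lambda>\<omega>. (Z \<omega>, x)) \<in> M \<rightarrow>\<^sub>M borel \<Otimes>\<^sub>M borel"
    by measurable
  from measurable_compose[OF this measurable_cond_cdf[OF f_meas]] show ?thesis
    by simp
qed

lemma nn_integral_cond_cdf:
  assumes "A \<in> sets borel"
  shows "(\<integral>\<^sup>+\<omega>. ennreal (cond_cdf f (Z \<omega>) x) * indicator A (Z \<omega>) \<partial>M) =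
    emeasure M {\<omega> \<in> space M. Z \<omega> \<in> A \<and> X \<omega> \<le> x}"
  unfolding nn_integral_cond_prob_le[OF assms, symmetric]
proof (rule nn_integral_cong_AE)
  show "AE \<omega> in M. ennreal (cond_cdf f (Z \<omega>) x) * indicator A (Z \<omega>) =
      ennreal (cond_prob_le M X Z x \<omega>) * indicator A (Z \<omega>)"
    using null[of x] by eventually_elim simp
qed

text \<open>Along the naturals, \<open>cond_cdf f (Z \<omega>)\<close> almost surely agrees with a
  conditional probability, hence is nondecreasing and bounded by 1. By monotone convergence its
  limit has mean 1, as \<open>X\<close> is finite, and a variable bounded by 1 with mean 1 is almost
  surely 1. Then \<open>nn_integral_density_eq_1\<close> turns the limit into the total mass of the
  density.\<close>

lemma AE_nn_integral_density_eq_1: "AE \<omega> in M. (\<integral>\<^sup>+s. f s (Z \<omega>) \<partial>lborel) = 1"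
proof -
  note [measurable] = measurable_cond_cdf_Z
  \<comment> \<open>The exceptional set in \<open>null\<close> depends on \<open>x\<close>, so only
    countably many levels can be treated at once.\<close>
  have le_Suc: "AE \<omega> in M. cond_cdf f (Z \<omega>) (real k) \<le> cond_cdf f (Z \<omega>) (real (Suc k))" for k
    using null[of "real k"] null[of "real (Suc k)"] AE_cond_prob_le_mono[of "real k" "real (Suc k)", OF of_nat_mono[OF le_SucI[OF order_refl]]]
    by eventually_elim simp
  then have inc: "AE \<omega> in M. incseq (\<lambda>k. cond_cdf f (Z \<omega>) (real k))"
    by (simp add: AE_all_countable incseq_Suc_iff)
  have "AE \<omega> in M. cond_cdf f (Z \<omega>) (real k) \<le> 1" for k
    using null[of "real k"] AE_cond_prob_le_le_1[of "real k"] by eventually_elim simp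
  then have "AE \<omega> in M. \<forall>k::nat. cond_cdf f (Z \<omega>) (real k) \<le> 1"
    by (simp add: AE_all_countable)
  then have le_1: "AE \<omega> in M. (SUP k::nat. ennreal (cond_cdf f (Z \<omega>) (real k))) \<le> 1"
    by eventually_elim (auto intro: SUP_least)
  have "(\<integral>\<^sup>+\<omega>. (SUP k::nat. ennreal (cond_cdf f (Z \<omega>) (real k))) \<partial>M) =
      (SUP k::nat. \<integral>\<^sup>+\<omega>. ennreal (cond_cdf f (Z \<omega>) (real k)) \<partial>M)"
  proof (rule nn_integral_monotone_convergence_SUP_AE)
    show "AE \<omega> in M. ennreal (cond_cdf f (Z \<omega>) (real k)) \<le> ennreal (cond_cdf f (Z \<omega>) (real (Suc k)))" for k
      using le_Suc[of k] by eventually_elim (rule ennreal_leI)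
  qed measurable
  also have "\<dots> = (SUP k::nat. emeasure M {\<omega> \<in> space M. X \<omega> \<le> real k})"
    using nn_integral_cond_cdf[of UNIV] by simp
  also have "\<dots> = emeasure M (\<Union>k::nat. {\<omega> \<in> space M. X \<omega> \<le> real k})"
    by (intro SUP_emeasure_incseq) (auto simp: incseq_def)
  also have "(\<Union>k::nat. {\<omega> \<in> space M. X \<omega> \<le> real k}) = space M"
    using real_arch_simple by auto
  finally have int: "(\<integral>\<^sup>+\<omega>. (SUP k::nat. ennreal (cond_cdf f (Z \<omega>) (real k))) \<partial>M) = 1"
    by (simp add: emeasure_space_1)
  have "(\<integral>\<^sup>+\<omega>. 1 - (SUP k::nat. ennreal (cond_cdf f (Z \<omega>) (real k))) \<partial>M) = 0"
    using le_1 by (subst nn_integral_diff) (auto simp: int emeasure_space_1)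
  \<comment> \<open>A nonnegative function with integral 0 vanishes almost everywhere; as
    subtraction on \<open>ennreal\<close> is truncated, this says that the supremum is at least
    1.\<close>
  then have "AE \<omega> in M. 1 - (SUP k::nat. ennreal (cond_cdf f (Z \<omega>) (real k))) = 0"
    by (subst (asm) nn_integral_0_iff_AE) auto
  with le_1 inc show ?thesis
  proof eventually_elim
    case (elim \<omega>)
    then show ?case
      by (intro nn_integral_density_eq_1 f_nonneg antisym borel_measurable_section[OF f_meas]) (auto simp: ennreal_minus_eq_0)
  qed
qed

text \<open>Tonelli's theorem with the integral over \<open>s\<close> inside, then the change of
  variables \<open>u = Z \<omega>\<close>: the measure is a mixture of the measures with density
  \<open>f\<close> at \<open>Z \<omega>\<close>.\<close>

lemma emeasure_density_pair:
  assumes S: "S \<in> sets (borel \<Otimes>\<^sub>M borel)"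
  shows "emeasure (density (distr M borel Z \<Otimes>\<^sub>M lborel) (\<lambda>(u, s). ennreal (f s u))) S =
    (\<integral>\<^sup>+\<omega>. emeasure (density lborel (\<lambda>s. f s (Z \<omega>))) (Pair (Z \<omega>) -` S) \<partial>M)"
proof -
  have sets_prod: "sets (distr M borel Z \<Otimes>\<^sub>M lborel) = sets (borel \<Otimes>\<^sub>M borel :: (real \<times> real) measure)"
    by (intro sets_pair_measure_cong) auto
  have dens: "(\<lambda>(u, s). ennreal (f s u)) \<in> borel_measurable (distr M borel Z \<Otimes>\<^sub>M lborel)"
  proof -
    have "(\<lambda>p. (snd p, fst p)) \<in> distr M borel Z \<Otimes>\<^sub>M lborel \<rightarrow>\<^sub>M borel \<Otimes>\<^sub>M borel"
      by measurable
    from measurable_compose[OF this f_meas] show ?thesis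
      by (simp add: split_beta')
  qed
  have S': "S \<in> sets (distr M borel Z \<Otimes>\<^sub>M lborel)"
    unfolding sets_prod by (rule S)
  note integrand = borel_measurable_times_ennreal[OF dens borel_measurable_indicator[OF S']]
  have "emeasure (density (distr M borel Z \<Otimes>\<^sub>M lborel) (\<lambda>(u, s). ennreal (f s u))) S =
      (\<integral>\<^sup>+p. (case p of (u, s) \<Rightarrow> ennreal (f s u)) * indicator S p \<partial>(distr M borel Z \<Otimes>\<^sub>M lborel))"
    by (rule emeasure_density[OF dens S'])
  also have "\<dots> = (\<integral>\<^sup>+u. \<integral>\<^sup>+s. ennreal (f s u) * indicator S (u, s) \<partial>lborel \<partial>distr M borel Z)"
    by (subst lborel.nn_integral_fst[OF integrand, symmetric]) simp
  also have "\<dots> = (\<integral>\<^sup>+\<omega>. \<integral>\<^sup>+s. ennreal (f s (Z \<omega>)) * indicator S (Z \<omega>, s) \<partial>lborel \<partial>M)"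
    using lborel.borel_measurable_nn_integral_fst[OF integrand] by (subst nn_integral_distr) simp_all
  also have "\<dots> = (\<integral>\<^sup>+\<omega>. emeasure (density lborel (\<lambda>s. f s (Z \<omega>))) (Pair (Z \<omega>) -` S) \<partial>M)"
  proof (intro nn_integral_cong)
    fix \<omega>
    have "Pair (Z \<omega>) -` S \<in> sets lborel"
      using sets_Pair1[OF S] by simp
    moreover have "(\<lambda>s. ennreal (f s (Z \<omega>))) \<in> borel_measurable lborel"
      using borel_measurable_section[OF f_meas] by simp
    ultimately show "(\<integral>\<^sup>+s. ennreal (f s (Z \<omega>)) * indicator S (Z \<omega>, s) \<partial>lborel) =
        emeasure (density lborel (\<lambda>s. f s (Z \<omega>))) (Pair (Z \<omega>) -` S)"
      by (subst emeasure_density) (auto intro!: nn_integral_cong simp: indicator_def)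
  qed
  finally show ?thesis .
qed

text \<open>The mixture gives \<open>A \<times> {..x}\<close> the mean of
  \<open>cond_cdf f (Z \<omega>) x\<close> over \<open>Z \<omega> \<in> A\<close>, because almost
  every section of \<open>f\<close> is a probability density; by the null hypothesis this is the
  joint probability. Passing to joint laws disposes of the null sets that depend on
  \<open>x\<close>, so that the random \<open>X \<omega>\<close> can later replace
  \<open>x\<close>.\<close>

lemma distr_pair_eq_density:
  "distr M (borel \<Otimes>\<^sub>M borel) (\<lambda>\<omega>. (Z \<omega>, X \<omega>)) =
    density (distr M borel Z \<Otimes>\<^sub>M lborel) (\<lambda>(u, s). ennreal (f s u))"
    (is "?J = ?K")
proof (rule measure_eqI_Times_atMost)
  have pair: "(\<lambda>\<omega>. (Z \<omega>, X \<omega>)) \<in> M \<rightarrow>\<^sub>M borel \<Otimes>\<^sub>M borel"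
    by measurable
  show "sets ?J = sets (borel \<Otimes>\<^sub>M borel)"
    by (rule sets_distr)
  have sets_prod: "sets (distr M borel Z \<Otimes>\<^sub>M lborel) = sets (borel \<Otimes>\<^sub>M borel :: (real \<times> real) measure)"
    by (intro sets_pair_measure_cong) auto
  then show "sets ?K = sets (borel \<Otimes>\<^sub>M borel)"
    by (simp only: sets_density)
  show "finite_measure ?J"
    by (rule prob_space.finite_measure[OF prob_space_distr[OF pair]])
  fix A and x :: real
  assume A: "A \<in> sets (borel :: real measure)"
  have Ax: "A \<times> {..x} \<in> sets (borel \<Otimes>\<^sub>M borel)"
    using A by (intro pair_measureI) simp_all
  have "emeasure ?K (A \<times> {..x}) =
      (\<integral>\<^sup>+\<omega>. emeasure (density lborel (\<lambda>s. f s (Z \<omega>))) (Pair (Z \<omega>) -` (A \<times> {..x})) \<partial>M)"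
    by (rule emeasure_density_pair[OF Ax])
  also have "\<dots> = (\<integral>\<^sup>+\<omega>. ennreal (cond_cdf f (Z \<omega>) x) * indicator A (Z \<omega>) \<partial>M)"
    using AE_nn_integral_density_eq_1
  proof (intro nn_integral_cong_AE, eventually_elim)
    fix \<omega>
    assume one: "(\<integral>\<^sup>+s. f s (Z \<omega>) \<partial>lborel) = 1"
    have "emeasure (density lborel (\<lambda>s. f s (Z \<omega>))) {..x} = ennreal (cond_cdf f (Z \<omega>) x)"
      by (rule emeasure_density_atMost[where f = f and u = "Z \<omega>", OF f_nonneg borel_measurable_section[OF f_meas] one])
    then show "emeasure (density lborel (\<lambda>s. f s (Z \<omega>))) (Pair (Z \<omega>) -` (A \<times> {..x})) =
        ennreal (cond_cdf f (Z \<omega>) x) * indicator A (Z \<omega>)"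
      by (cases "Z \<omega> \<in> A") simp_all
  qed
  also have "\<dots> = emeasure M {\<omega> \<in> space M. Z \<omega> \<in> A \<and> X \<omega> \<le> x}"
    by (rule nn_integral_cond_cdf[OF A])
  also have "\<dots> = emeasure ?J (A \<times> {..x})"
    by (subst emeasure_distr[OF pair Ax]) (auto intro!: arg_cong[of _ _ "emeasure M"])
  finally show "emeasure ?J (A \<times> {..x}) = emeasure ?K (A \<times> {..x})" ..
qed

text \<open>In the mixture over \<open>u = Z \<omega>\<close>, the integral transform gives almost
  every component the same value \<open>unif_cdf t\<close>, and averaging preserves a
  constant.\<close>

lemma prob_cond_cdf_le: "prob {\<omega> \<in> space M. cond_cdf f (Z \<omega>) (X \<omega>) \<le> t} = unif_cdf t"
proof -
  let ?S = "{(u, s). cond_cdf f u s \<le> t}"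
  have S: "?S \<in> sets (borel \<Otimes>\<^sub>M borel)"
  proof -
    note [measurable] = measurable_cond_cdf[OF f_meas]
    have "{p \<in> space (borel \<Otimes>\<^sub>M borel). case p of (u, s) \<Rightarrow> cond_cdf f u s \<le> t} \<in> sets (borel \<Otimes>\<^sub>M borel)"
      by measurable
    then show ?thesis
      by (simp add: space_pair_measure)
  qed
  have pair: "(\<lambda>\<omega>. (Z \<omega>, X \<omega>)) \<in> M \<rightarrow>\<^sub>M borel \<Otimes>\<^sub>M borel"
    by measurable
  have "emeasure M {\<omega> \<in> space M. cond_cdf f (Z \<omega>) (X \<omega>) \<le> t} =
      emeasure (distr M (borel \<Otimes>\<^sub>M borel) (\<lambda>\<omega>. (Z \<omega>, X \<omega>))) ?S"
    by (subst emeasure_distr[OF pair S]) (auto intro!: arg_cong[of _ _ "emeasure M"])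
  also have "\<dots> = (\<integral>\<^sup>+\<omega>. emeasure (density lborel (\<lambda>s. f s (Z \<omega>))) (Pair (Z \<omega>) -` ?S) \<partial>M)"
    unfolding distr_pair_eq_density by (rule emeasure_density_pair[OF S])
  also have "\<dots> = (\<integral>\<^sup>+\<omega>. ennreal (unif_cdf t) \<partial>M)"
    using AE_nn_integral_density_eq_1
  proof (intro nn_integral_cong_AE, eventually_elim)
    fix \<omega>
    assume one: "(\<integral>\<^sup>+s. f s (Z \<omega>) \<partial>lborel) = 1"
    note density = f_nonneg borel_measurable_section[OF f_meas] one
    interpret D: real_distribution "density lborel (\<lambda>s. f s (Z \<omega>))"
      by (rule real_distribution_density[where f = f and u = "Z \<omega>", OF density])
    have "D.prob {s. cond_cdf f (Z \<omega>) s \<le> t} = unif_cdf t"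
      using D.cdf_probability_integral_transform
        [OF continuous_on_cdf_density[where f = f and u = "Z \<omega>", OF density]]
      unfolding cdf_density[where f = f and u = "Z \<omega>", OF density] .
    then show "emeasure (density lborel (\<lambda>s. f s (Z \<omega>))) (Pair (Z \<omega>) -` ?S) = ennreal (unif_cdf t)"
      by (simp add: D.emeasure_eq_measure vimage_def)
  qed
  also have "\<dots> = ennreal (unif_cdf t)"
    by (simp add: emeasure_space_1)
  finally show ?thesis
    by (simp add: emeasure_eq_measure unif_cdf_bounds)
qed

lemma measurable_cond_cdf_Z_X: "(\<lambda>\<omega>. cond_cdf f (Z \<omega>) (X \<omega>)) \<in> borel_measurable M"
proof -
  have "(\<lambda>\<omega>. (Z \<omega>, X \<omega>)) \<in> M \<rightarrow>\<^sub>M borel \<Otimes>\<^sub>M borel"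
    by measurable
  from measurable_compose[OF this measurable_cond_cdf[OF f_meas]] show ?thesis
    by simp
qed

lemma cdf_distr_cond_cdf: "cdf (distr M borel (\<lambda>\<omega>. cond_cdf f (Z \<omega>) (X \<omega>))) = unif_cdf"
proof
  fix t
  have "cdf (distr M borel (\<lambda>\<omega>. cond_cdf f (Z \<omega>) (X \<omega>))) t =
      prob {\<omega> \<in> space M. cond_cdf f (Z \<omega>) (X \<omega>) \<le> t}"
    using measurable_cond_cdf_Z_X by (auto simp: cdf_def measure_distr intro!: arg_cong[of _ _ prob])
  then show "cdf (distr M borel (\<lambda>\<omega>. cond_cdf f (Z \<omega>) (X \<omega>))) t = unif_cdf t"
    by (simp add: prob_cond_cdf_le)
qed

end
end
end

section \<open>Reduction of S_n to the KS statistic and conclusion\<close>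

text \<open>For nonnegative \<open>v i\<close> the sets \<open>{0..x}\<close> and
  \<open>{..x}\<close> count the same points, and moving \<open>x\<close> to the nearest point of
  the unit interval never lowers the deviation. Values above 1 are allowed: \<open>cond_cdf\<close>
  is nonnegative everywhere, but its bound by 1 is an almost sure one.\<close>

lemma SUP_unit_interval_eq_ks_statistic:
  assumes "n \<ge> 1" and nonneg: "\<And>i. i \<in> {1..n} \<Longrightarrow> 0 \<le> v i"
  shows "(SUP x\<in>{0..1}. \<bar>1 / real n * (\<Sum>i=1..n. indicator {0..x} (v i)) - x\<bar>) =
    ks_statistic n unif_cdf v"
proof -
  define h where "h x = \<bar>1 / real n * (\<Sum>i=1..n. indicator {..x} (v i)) - unif_cdf x\<bar>" for x
  have bdd: "bdd_above (h ` A)" for A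
    unfolding h_def by (intro ks_bdd_above unif_cdf_bounds)
  have h01: "\<bar>1 / real n * (\<Sum>i=1..n. indicator {0..x} (v i)) - x\<bar> = h x" if "x \<in> {0..1}" for x
  proof -
    have "(\<Sum>i=1..n. indicator {0..x} (v i) :: real) = (\<Sum>i=1..n. indicator {..x} (v i))"
      using nonneg by (intro sum.cong) (auto simp: indicator_def)
    with that show ?thesis by (simp add: h_def unif_cdf_def)
  qed
  have clamp: "h x \<le> h (unif_cdf x)" for x
  proof -
    consider "x < 0" | "0 \<le> x" "x \<le> 1" | "1 < x" by linarith
    then show ?thesis
    proof cases
      case 1
      then have "(\<Sum>i=1..n. indicator {..x} (v i) :: real) = 0"
        using nonneg by (intro sum.neutral) (force simp: indicator_def)
      with 1 have "h x = 0" by (simp add: h_def unif_cdf_def)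
      then show ?thesis by (simp add: h_def)
    next
      case 2
      then show ?thesis by (simp add: unif_cdf_def)
    next
      case 3
      \<comment> \<open>Beyond 1 the uniform distribution function stays at 1, while the empirical
        one can only grow towards 1.\<close>
      define a b where "a = (\<Sum>i=1..n. indicator {..1} (v i) :: real)"
        and "b = (\<Sum>i=1..n. indicator {..x} (v i) :: real)"
      have "a \<le> b"
        unfolding a_def b_def using 3 by (intro sum_mono) (auto simp: indicator_def)
      moreover have "b \<le> (\<Sum>i=1..n. 1)"
        unfolding b_def by (intro sum_mono) (auto simp: indicator_def)
      ultimately have "1 / real n * a \<le> 1 / real n * b" "1 / real n * b \<le> 1"
        using \<open>n \<ge> 1\<close> by (auto simp: field_simps)
      then have "\<bar>1 / real n * b - 1\<bar> \<le> \<bar>1 / real n * a - 1\<bar>"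
        by linarith
      with 3 show ?thesis
        unfolding h_def a_def b_def by (simp add: unif_cdf_def)
    qed
  qed
  have "(SUP x\<in>{0..1}. h x) = (SUP x. h x)"
  proof (rule antisym)
    show "(SUP x\<in>{0..1}. h x) \<le> (SUP x. h x)"
      by (intro cSUP_subset_mono bdd) auto
    show "(SUP x. h x) \<le> (SUP x\<in>{0..1}. h x)"
    proof (rule cSUP_least)
      fix x
      have "h (unif_cdf x) \<le> (SUP x\<in>{0..1}. h x)"
        using unif_cdf_bounds by (intro cSUP_upper bdd) auto
      then show "h x \<le> (SUP x\<in>{0..1}. h x)"
        using clamp[of x] by linarith
    qed simp
  qed
  then show ?thesis
    by (simp only: ks_statistic_def h_def[symmetric] h01 cong: SUP_cong)
qed

theorem theorem3p10:
  fixes M :: "'a measure"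
    and \<zeta> \<xi> :: "nat \<Rightarrow> 'a \<Rightarrow> real"
    and f :: "real \<Rightarrow> real \<Rightarrow> real"
    and n :: nat
  assumes "prob_space M"
    and "n \<ge> 1"
    and "\<And>i. i \<in> {1..n} \<Longrightarrow> \<zeta> i \<in> borel_measurable M"
    and "\<And>i. i \<in> {1..n} \<Longrightarrow> \<xi> i \<in> borel_measurable M"
    and "prob_space.indep_vars M (\<lambda>_. borel) \<zeta> {1..n}"
    and "\<And>i j. i \<in> {1..n} \<Longrightarrow> j \<in> {1..n} \<Longrightarrow> distr M borel (\<zeta> i) = distr M borel (\<zeta> j)"
    and "prob_space.indep_vars M (\<lambda>_. borel \<Otimes>\<^sub>M borel) (\<lambda>i \<omega>. (\<zeta> i \<omega>, \<xi> i \<omega>)) {1..n}"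
    and "(\<lambda>(s, u). f s u) \<in> borel_measurable (borel \<Otimes>\<^sub>M borel)"
    and "\<And>s u. f s u \<ge> 0"
    and "\<And>i x. i \<in> {1..n} \<Longrightarrow>
           AE \<omega> in M. cond_prob_le M (\<xi> i) (\<zeta> i) x \<omega> = cond_cdf f (\<zeta> i \<omega>) x"
    and "\<And>i. i \<in> {1..n} \<Longrightarrow> AE \<omega> in M. continuous_on UNIV (cond_cdf f (\<zeta> i \<omega>))"
  shows "KS_distributed M n
    (\<lambda>\<omega>. SUP x\<in>{0..1}.
       \<bar>1 / real n * (\<Sum>i=1..n. indicator {0..x} (cond_cdf f (\<zeta> i \<omega>) (\<xi> i \<omega>))) - x\<bar>)"
proof -
  interpret prob_space M by fact
  let ?U = "\<lambda>i \<omega>. cond_cdf f (\<zeta> i \<omega>) (\<xi> i \<omega>)"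
  let ?U' = "\<lambda>\<omega>. \<lambda>i\<in>{1..n}. ?U i \<omega>"
  have S_eq: "(\<lambda>\<omega>. SUP x\<in>{0..1}. \<bar>1 / real n * (\<Sum>i=1..n. indicator {0..x} (?U i \<omega>)) - x\<bar>) =
      (\<lambda>\<omega>. ks_statistic n unif_cdf (\<lambda>i. ?U i \<omega>))"
    by (rule ext, rule SUP_unit_interval_eq_ks_statistic) (rule \<open>n \<ge> 1\<close>, rule cond_cdf_nonneg[OF assms(9)])
  have U_meas: "?U i \<in> borel_measurable M" if "i \<in> {1..n}" for i
    by (rule measurable_cond_cdf_Z_X[OF assms(4)[OF that] assms(3)[OF that] assms(8,9) assms(10)[OF that]])
  have U'_meas: "?U' \<in> M \<rightarrow>\<^sub>M (\<Pi>\<^sub>M i\<in>{1..n}. borel)"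
    by (intro measurable_restrict U_meas)
  have ks_meas: "ks_statistic n unif_cdf \<in> borel_measurable (\<Pi>\<^sub>M i\<in>{1..n}. borel)"
    by (rule measurable_ks_statistic[OF continuous_on_unif_cdf unif_cdf_bounds]) measurable
  \<comment> \<open>Each \<open>?U i\<close> is the same measurable function of the pair with index
    \<open>i\<close>, and the pairs are independent.\<close>
  have "indep_vars (\<lambda>_. borel) (\<lambda>i \<omega>. case_prod (cond_cdf f) (\<zeta> i \<omega>, \<xi> i \<omega>)) {1..n}"
    by (rule indep_vars_compose2[OF assms(7) measurable_cond_cdf[OF assms(8)]])
  then have U_indep: "indep_vars (\<lambda>_. borel) ?U {1..n}"
    by (simp only: prod.case)
  have nonempty: "{1..n} \<noteq> {}"
    using \<open>n \<ge> 1\<close> by simp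
  have indep: "distr M (\<Pi>\<^sub>M i\<in>{1..n}. borel) ?U' = (\<Pi>\<^sub>M i\<in>{1..n}. distr M borel (?U i))"
    by (rule iffD1[OF indep_vars_iff_distr_eq_PiM'[OF nonempty U_meas] U_indep])
  have "distr M borel (\<lambda>\<omega>. ks_statistic n unif_cdf (\<lambda>i. ?U i \<omega>)) =
      distr (\<Pi>\<^sub>M i\<in>{1..n}. \<mu>) borel (ks_statistic n (cdf \<mu>))"
    if \<mu>: "real_distribution \<mu>" "continuous_on UNIV (cdf \<mu>)" for \<mu>
  proof -
    interpret \<mu>: real_distribution \<mu> by fact
    \<comment> \<open>Both laws have distribution function \<open>unif_cdf\<close>, which determines
      them.\<close>
    have "distr M borel (?U i) = distr \<mu> borel (cdf \<mu>)" if i: "i \<in> {1..n}" for i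
    proof (rule cdf_unique)
      show "real_distribution (distr M borel (?U i))"
        using U_meas[OF i] by (rule real_distribution_distr)
      show "real_distribution (distr \<mu> borel (cdf \<mu>))"
        by (rule \<mu>.real_distribution_distr) simp
      have "cdf (distr M borel (?U i)) = unif_cdf"
        by (rule cdf_distr_cond_cdf[OF assms(4)[OF i] assms(3)[OF i] assms(8,9) assms(10)[OF i]])
      then show "cdf (distr M borel (?U i)) = cdf (distr \<mu> borel (cdf \<mu>))"
        by (simp add: \<mu>.cdf_distr_cdf[OF \<mu>(2)])
    qed
    then have PiM_eq: "(\<Pi>\<^sub>M i\<in>{1..n}. distr M borel (?U i)) = (\<Pi>\<^sub>M i\<in>{1..n}. distr \<mu> borel (cdf \<mu>))"
      by (intro PiM_cong) auto
    \<comment> \<open>The statistic reads only the coordinates in \<open>{1..n}\<close>, so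
      restricting the sample to them, as the product space demands, is harmless.\<close>
    have "distr M borel (\<lambda>\<omega>. ks_statistic n unif_cdf (\<lambda>i. ?U i \<omega>)) =
        distr M borel (ks_statistic n unif_cdf \<circ> ?U')"
      by (simp add: ks_statistic_def o_def)
    also have "\<dots> = distr (distr M (\<Pi>\<^sub>M i\<in>{1..n}. borel) ?U') borel (ks_statistic n unif_cdf)"
      using distr_distr[OF ks_meas U'_meas] by simp
    also have "\<dots> = distr (\<Pi>\<^sub>M i\<in>{1..n}. \<mu>) borel (ks_statistic n (cdf \<mu>))"
      unfolding indep PiM_eq using \<mu>.distr_ks_statistic[OF \<mu>(2) \<open>n \<ge> 1\<close>] by simp
    finally show ?thesis .
  qed
  moreover have "(\<lambda>\<omega>. ks_statistic n unif_cdf (\<lambda>i. ?U i \<omega>)) \<in> borel_measurable M"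
    by (rule measurable_ks_statistic[OF continuous_on_unif_cdf unif_cdf_bounds U_meas])
  ultimately show ?thesis
    unfolding KS_distributed_def S_eq by blast
qed

end
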